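(* Let $\mathcal{C}$ be a finitely aligned left cancellative small category and let $\pi$ be a finitely join-preserving representation of $\mathrm{ZM}(\mathcal{C})$ in a $C^*$-algebra $B$. Let $\pi_t\colon\mathrm{ZM}(\mathcal{C})\to\mathcal{T}(\mathcal{C})$ be the unique finitely join-preserving representation satisfying $\pi_t(\tau_\alpha)=t_\alpha$ for all $\alpha\in\mathcal{C}$. Then there is a unique homomorphism $\phi^\pi\colon\mathcal{T}(\mathcal{C})\to B$ such that $\phi^\pi\circ\pi_t=\pi$.
   Context: Small categories: a small category $\mathcal{C}$ is identified with its set of morphisms; $\mathcal{C}^0\subseteq\mathcal{C}$ (nonempty) is the set of vertices (objects, identified with identity morphisms), $r,s\colon\mathcal{C}\to\mathcal{C}^0$ are the range and source maps, and $\alpha\beta$ is defined iff $s(\alpha)=r(\beta)$. $\mathcal{C}$ is left cancellative if $\alpha\beta=\alpha\gamma$ implies $\beta=\gamma$. Write $\alpha\mathcal{C}=\{\alpha\beta: r(\beta)=s(\alpha)\}$. $\mathcal{C}$ is finitely aligned if for all $\alpha,\beta\in\mathcal{C}$ there is a finite (possibly empty) $F\subseteq\mathcal{C}$ with $\alpha\mathcal{C}\cap\beta\mathcal{C}=\bigcup_{\gamma\in F}\gamma\mathcal{C}$; $\alpha\vee\beta$ denotes any such $F$ that is independent ($\gamma\notin\gamma'\mathcal{C}$ for distinct $\gamma,\gamma'\in F$). Representations: a representation of $\mathcal{C}$ in a $C^*$-algebra $B$ is a map $T\colon\mathcal{C}\to B$ such that for all $\alpha,\beta$: $T_\alpha^*T_\alpha=T_{s(\alpha)}$;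 $T_\alpha T_\beta=T_{\alpha\beta}$ if $s(\alpha)=r(\beta)$; $T_\alpha T_\alpha^*T_\beta T_\beta^*=\bigvee_{\gamma\in\alpha\vee\beta}T_\gamma T_\gamma^*$ (join of projections, a priori in $B^{**}$; empty join $=0$). The Toeplitz algebra $(\mathcal{T}(\mathcal{C}),t)$ is universal for representations of $\mathcal{C}$: $t\colon\mathcal{C}\to\mathcal{T}(\mathcal{C})$ is a representation and for every representation $T$ in $B$ there is a unique homomorphism $\phi_T\colon\mathcal{T}(\mathcal{C})\to B$ with $\phi_T(t_\alpha)=T_\alpha$. Zigzag maps: for $\alpha\in\mathcal{C}$ let $\tau_\alpha\colon s(\alpha)\mathcal{C}\to\alpha\mathcal{C}$, $\tau_\alpha(\beta)=\alpha\beta$, a bijection with inverse $\sigma_\alpha$. $\mathrm{ZM}(\mathcal{C})$ is the inverse subsemigroup of the symmetric inverse semigroup $I(\mathcal{C})$ (partial bijections of $\mathcal{C}$, composed on the largest possible domain) generated by $\{\tau_\alpha\}_{\alpha\in\mathcal{C}}\cup\{\mathrm{id}_\varnothing\}$. A zigzag is a tuple $\zeta=(\alpha_1,\beta_1,\dots,\alpha_n,\beta_n)$ with $r(\alpha_i)=r(\beta_i)$ and $s(\beta_i)=s(\alpha_{i+1})$; $\mathcal{Z}_{\mathcal{C}}$ is the set of zigzags, $\varphi_\zeta=\sigma_{\alpha_1}\tau_{\beta_1}\cdots\sigma_{\alpha_n}\tau_{\beta_n}$, and $A(\zeta)$ is the domain of $\varphi_\zeta$. One has $\mathrm{ZM}(\mathcal{C})=\{\varphi_\zeta:\zeta\in\mathcal{Z}_{\mathcal{C}}\}\cup\{\mathrm{id}_\varnothing\}$,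 with idempotents $\mathrm{id}_{A(\zeta)}$ and $\mathrm{id}_\varnothing$. A representation of $\mathrm{ZM}(\mathcal{C})$ in a $C^*$-algebra $B$ is a multiplicative, $*$-preserving map $\pi\colon\mathrm{ZM}(\mathcal{C})\to B$ (with $\pi(\varphi^{-1})=\pi(\varphi)^*$) and $\pi(\mathrm{id}_\varnothing)=0$. It is finitely join-preserving if for all $\zeta,\zeta_1,\dots,\zeta_n\in\mathcal{Z}_{\mathcal{C}}$ with $A(\zeta)=\bigcup_{j=1}^nA(\zeta_j)$ one has $\pi(\mathrm{id}_{A(\zeta)})=\bigvee_{j=1}^n\pi(\mathrm{id}_{A(\zeta_j)})$ (join of projections). *)

theory Defs
  imports "HOL-Library.FuncSet" Complex_Main
begin

section \<open>C*-algebras\<close>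

record 'a normed_sp =
  carrier :: "'a set"
  zero :: 'a ("\<zero>\<index>")
  add :: "'a \<Rightarrow> 'a \<Rightarrow> 'a" (infixl "\<oplus>\<index>" 65)
  scale :: "complex \<Rightarrow> 'a \<Rightarrow> 'a" (infixr "\<odot>\<index>" 75)
  nrm :: "'a \<Rightarrow> real"

record 'a cstar = "'a normed_sp" +
  mult :: "'a \<Rightarrow> 'a \<Rightarrow> 'a" (infixl "\<otimes>\<index>" 70)
  star :: "'a \<Rightarrow> 'a"

definition sub :: "('a, 'm) normed_sp_scheme \<Rightarrow> 'a \<Rightarrow> 'a \<Rightarrow> 'a" where
  "sub V x y = x \<oplus>\<^bsub>V\<^esub> ((-1) \<odot>\<^bsub>V\<^esub> y)"

locale complex_normed_sp =
  fixes V :: "('a, 'm) normed_sp_scheme" (structure)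
  assumes zero_closed: "\<zero> \<in> carrier V"
    and add_closed: "x \<in> carrier V \<Longrightarrow> y \<in> carrier V \<Longrightarrow> x \<oplus> y \<in> carrier V"
    and scale_closed: "x \<in> carrier V \<Longrightarrow> c \<odot> x \<in> carrier V"
    and add_assoc: "x \<in> carrier V \<Longrightarrow> y \<in> carrier V \<Longrightarrow> z \<in> carrier V \<Longrightarrow>
      (x \<oplus> y) \<oplus> z = x \<oplus> (y \<oplus> z)"
    and add_commute: "x \<in> carrier V \<Longrightarrow> y \<in> carrier V \<Longrightarrow> x \<oplus> y = y \<oplus> x"
    and add_zero: "x \<in> carrier V \<Longrightarrow> x \<oplus> \<zero> = x"
    and add_neg: "x \<in> carrier V \<Longrightarrow> x \<oplus> ((-1) \<odot> x) = \<zero>"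
    and scale_add_right: "x \<in> carrier V \<Longrightarrow> y \<in> carrier V \<Longrightarrow> c \<odot> (x \<oplus> y) = (c \<odot> x) \<oplus> (c \<odot> y)"
    and scale_add_left: "x \<in> carrier V \<Longrightarrow> (c + d) \<odot> x = (c \<odot> x) \<oplus> (d \<odot> x)"
    and scale_scale: "x \<in> carrier V \<Longrightarrow> c \<odot> (d \<odot> x) = (c * d) \<odot> x"
    and scale_one: "x \<in> carrier V \<Longrightarrow> 1 \<odot> x = x"
    and nrm_nonneg: "x \<in> carrier V \<Longrightarrow> 0 \<le> nrm V x"
    and nrm_eq_0: "x \<in> carrier V \<Longrightarrow> nrm V x = 0 \<longleftrightarrow> x = \<zero>"
    and nrm_add: "x \<in> carrier V \<Longrightarrow> y \<in> carrier V \<Longrightarrow> nrm V (x \<oplus> y) \<le> nrm V x + nrm V y"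
    and nrm_scale: "x \<in> carrier V \<Longrightarrow> nrm V (c \<odot> x) = cmod c * nrm V x"

text \<open>No unit is required, and the zero algebra is allowed.\<close>

locale cstar_algebra = complex_normed_sp A for A :: "('a, 'm) cstar_scheme" (structure) +
  assumes complete: "(\<And>n :: nat. \<sigma> n \<in> carrier A) \<Longrightarrow>
      (\<forall>e > 0. \<exists>N. \<forall>m \<ge> N. \<forall>n \<ge> N. nrm A (sub A (\<sigma> m) (\<sigma> n)) < e) \<Longrightarrow>
      \<exists>x \<in> carrier A. (\<lambda>n. nrm A (sub A (\<sigma> n) x)) \<longlonglongrightarrow> 0"
    and mult_closed: "x \<in> carrier A \<Longrightarrow> y \<in> carrier A \<Longrightarrow> x \<otimes> y \<in> carrier A"
    and mult_assoc: "x \<in> carrier A \<Longrightarrow> y \<in> carrier A \<Longrightarrow> z \<in> carrier A \<Longrightarrow>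
      (x \<otimes> y) \<otimes> z = x \<otimes> (y \<otimes> z)"
    and distrib_left: "x \<in> carrier A \<Longrightarrow> y \<in> carrier A \<Longrightarrow> z \<in> carrier A \<Longrightarrow>
      x \<otimes> (y \<oplus> z) = (x \<otimes> y) \<oplus> (x \<otimes> z)"
    and distrib_right: "x \<in> carrier A \<Longrightarrow> y \<in> carrier A \<Longrightarrow> z \<in> carrier A \<Longrightarrow>
      (x \<oplus> y) \<otimes> z = (x \<otimes> z) \<oplus> (y \<otimes> z)"
    and scale_mult_left: "x \<in> carrier A \<Longrightarrow> y \<in> carrier A \<Longrightarrow> (c \<odot> x) \<otimes> y = c \<odot> (x \<otimes> y)"
    and scale_mult_right: "x \<in> carrier A \<Longrightarrow> y \<in> carrier A \<Longrightarrow> x \<otimes> (c \<odot> y) = c \<odot> (x \<otimes> y)"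
    and star_closed: "x \<in> carrier A \<Longrightarrow> star A x \<in> carrier A"
    and star_star: "x \<in> carrier A \<Longrightarrow> star A (star A x) = x"
    and star_add: "x \<in> carrier A \<Longrightarrow> y \<in> carrier A \<Longrightarrow> star A (x \<oplus> y) = star A x \<oplus> star A y"
    and star_scale: "x \<in> carrier A \<Longrightarrow> star A (c \<odot> x) = cnj c \<odot> star A x"
    and star_mult: "x \<in> carrier A \<Longrightarrow> y \<in> carrier A \<Longrightarrow> star A (x \<otimes> y) = star A y \<otimes> star A x"
    and nrm_mult: "x \<in> carrier A \<Longrightarrow> y \<in> carrier A \<Longrightarrow> nrm A (x \<otimes> y) \<le> nrm A x * nrm A y"
    and cstar_identity: "x \<in> carrier A \<Longrightarrow> nrm A (star A x \<otimes> x) = (nrm A x)\<^sup>2"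

text \<open>Homomorphisms are *-homomorphisms, not assumed unital. They are extensional functions,
  so that equality of homomorphisms is equality on the carrier.\<close>

definition cstar_hom :: "('a, 'm) cstar_scheme \<Rightarrow> ('b, 'n) cstar_scheme \<Rightarrow> ('a \<Rightarrow> 'b) set" where
  "cstar_hom A B = {\<phi> \<in> carrier A \<rightarrow>\<^sub>E carrier B.
     (\<forall>x \<in> carrier A. \<forall>y \<in> carrier A. \<phi> (x \<oplus>\<^bsub>A\<^esub> y) = \<phi> x \<oplus>\<^bsub>B\<^esub> \<phi> y) \<and>
     (\<forall>c. \<forall>x \<in> carrier A. \<phi> (c \<odot>\<^bsub>A\<^esub> x) = c \<odot>\<^bsub>B\<^esub> \<phi> x) \<and>
     (\<forall>x \<in> carrier A. \<forall>y \<in> carrier A. \<phi> (x \<otimes>\<^bsub>A\<^esub> y) = \<phi> x \<otimes>\<^bsub>B\<^esub> \<phi> y) \<and>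
     (\<forall>x \<in> carrier A. \<phi> (star A x) = star B (\<phi> x))}"


section \<open>The bidual of a C*-algebra and joins of projections\<close>

text \<open>The Banach space dual: bounded linear functionals with the operator norm.\<close>

definition dual :: "('a, 'm) normed_sp_scheme \<Rightarrow> ('a \<Rightarrow> complex) normed_sp" where
  "dual V = \<lparr>
     carrier = {f \<in> extensional (carrier V).
       (\<forall>x \<in> carrier V. \<forall>y \<in> carrier V. f (x \<oplus>\<^bsub>V\<^esub> y) = f x + f y) \<and>
       (\<forall>c. \<forall>x \<in> carrier V. f (c \<odot>\<^bsub>V\<^esub> x) = c * f x) \<and>
       (\<exists>K. \<forall>x \<in> carrier V. cmod (f x) \<le> K * nrm V x)},
     zero = (\<lambda>x \<in> carrier V. 0),
     add = (\<lambda>f g. \<lambda>x \<in> carrier V. f x + g x),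
     scale = (\<lambda>c f. \<lambda>x \<in> carrier V. c * f x),
     nrm = (\<lambda>f. Sup {cmod (f x) | x. x \<in> carrier V \<and> nrm V x \<le> 1}) \<rparr>"

text \<open>
  The bidual \<open>B**\<close> with the Arens product
  \<open>(\<Phi>\<Psi>)(f) = \<Phi>(a \<mapsto> \<Psi>(b \<mapsto> f(ab)))\<close> and the involution
  \<open>\<Phi>*(f) = cnj (\<Phi>(f*))\<close>, where \<open>f*(a) = cnj (f(a*))\<close>. For a C*-algebra
  this is the enveloping von Neumann algebra.
\<close>

definition bidual :: "('b, 'm) cstar_scheme \<Rightarrow> (('b \<Rightarrow> complex) \<Rightarrow> complex) cstar" where
  "bidual B = normed_sp.extend (dual (dual B)) (cstar.fields
     (\<lambda>\<Phi> \<Psi>. \<lambda>f \<in> carrier (dual B).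
        \<Phi> (\<lambda>a \<in> carrier B. \<Psi> (\<lambda>b \<in> carrier B. f (a \<otimes>\<^bsub>B\<^esub> b))))
     (\<lambda>\<Phi>. \<lambda>f \<in> carrier (dual B). cnj (\<Phi> (\<lambda>a \<in> carrier B. cnj (f (star B a))))))"

definition bidual_emb :: "('b, 'm) cstar_scheme \<Rightarrow> 'b \<Rightarrow> ('b \<Rightarrow> complex) \<Rightarrow> complex" where
  "bidual_emb B a = (\<lambda>f \<in> carrier (dual B). f a)"

definition projection :: "('a, 'm) cstar_scheme \<Rightarrow> 'a \<Rightarrow> bool" where
  "projection A p \<longleftrightarrow> p \<in> carrier A \<and> p \<otimes>\<^bsub>A\<^esub> p = p \<and> star A p = p"

definition proj_le :: "('a, 'm) cstar_scheme \<Rightarrow> 'a \<Rightarrow> 'a \<Rightarrow> bool" where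
  "proj_le A p q \<longleftrightarrow> p \<otimes>\<^bsub>A\<^esub> q = p"

definition is_proj_lub :: "('a, 'm) cstar_scheme \<Rightarrow> 'a set \<Rightarrow> 'a \<Rightarrow> bool" where
  "is_proj_lub A P q \<longleftrightarrow> projection A q \<and> (\<forall>p \<in> P. proj_le A p q) \<and>
     (\<forall>r. projection A r \<and> (\<forall>p \<in> P. proj_le A p r) \<longrightarrow> proj_le A q r)"

text \<open>\<open>q \<in> B\<close> is the join, formed in \<open>B**\<close>, of the set \<open>P\<close> of projections of \<open>B\<close>.
  The empty join is \<open>0\<close>.\<close>

definition is_join :: "('b, 'm) cstar_scheme \<Rightarrow> 'b set \<Rightarrow> 'b \<Rightarrow> bool" where
  "is_join B P q \<longleftrightarrow> q \<in> carrier B \<and> (\<forall>p \<in> P. projection B p) \<and>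
     is_proj_lub (bidual B) (bidual_emb B ` P) (bidual_emb B q)"


section \<open>Left cancellative small categories\<close>

text \<open>\<open>cmp C a b\<close> is meaningful only if \<open>src C a = rng C b\<close>.\<close>

record 'c cat =
  mor :: "'c set"
  obj :: "'c set"
  rng :: "'c \<Rightarrow> 'c"
  src :: "'c \<Rightarrow> 'c"
  cmp :: "'c \<Rightarrow> 'c \<Rightarrow> 'c" (infixl "\<cdot>\<index>" 70)

locale small_category =
  fixes C :: "('c, 'm) cat_scheme" (structure)
  assumes obj_mor: "obj C \<subseteq> mor C"
    and obj_nonempty: "obj C \<noteq> {}"
    and rng_obj: "a \<in> mor C \<Longrightarrow> rng C a \<in> obj C"
    and src_obj: "a \<in> mor C \<Longrightarrow> src C a \<in> obj C"
    and rng_id: "v \<in> obj C \<Longrightarrow> rng C v = v"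
    and src_id: "v \<in> obj C \<Longrightarrow> src C v = v"
    and cmp_closed: "a \<in> mor C \<Longrightarrow> b \<in> mor C \<Longrightarrow> src C a = rng C b \<Longrightarrow> a \<cdot> b \<in> mor C"
    and rng_cmp: "a \<in> mor C \<Longrightarrow> b \<in> mor C \<Longrightarrow> src C a = rng C b \<Longrightarrow> rng C (a \<cdot> b) = rng C a"
    and src_cmp: "a \<in> mor C \<Longrightarrow> b \<in> mor C \<Longrightarrow> src C a = rng C b \<Longrightarrow> src C (a \<cdot> b) = src C b"
    and cmp_assoc: "a \<in> mor C \<Longrightarrow> b \<in> mor C \<Longrightarrow> c \<in> mor C \<Longrightarrow>
      src C a = rng C b \<Longrightarrow> src C b = rng C c \<Longrightarrow> (a \<cdot> b) \<cdot> c = a \<cdot> (b \<cdot> c)"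
    and cmp_rng: "a \<in> mor C \<Longrightarrow> rng C a \<cdot> a = a"
    and cmp_src: "a \<in> mor C \<Longrightarrow> a \<cdot> src C a = a"

locale left_cancellative_category = small_category +
  assumes left_cancel: "a \<in> mor C \<Longrightarrow> b \<in> mor C \<Longrightarrow> c \<in> mor C \<Longrightarrow>
    src C a = rng C b \<Longrightarrow> src C a = rng C c \<Longrightarrow> a \<cdot> b = a \<cdot> c \<Longrightarrow> b = c"

text \<open>The right ideal \<open>aC\<close>; for an object \<open>v\<close> this is \<open>vC = {b. rng b = v}\<close>.\<close>

definition right_ideal :: "('c, 'm) cat_scheme \<Rightarrow> 'c \<Rightarrow> 'c set" where
  "right_ideal C a = {a \<cdot>\<^bsub>C\<^esub> b | b. b \<in> mor C \<and> rng C b = src C a}"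

definition finitely_aligned :: "('c, 'm) cat_scheme \<Rightarrow> bool" where
  "finitely_aligned C \<longleftrightarrow> (\<forall>a \<in> mor C. \<forall>b \<in> mor C. \<exists>F. finite F \<and> F \<subseteq> mor C \<and>
     right_ideal C a \<inter> right_ideal C b = (\<Union>c \<in> F. right_ideal C c))"

text \<open>\<open>F\<close> is a possible choice for \<open>a \<or> b\<close>.\<close>

definition is_vee :: "('c, 'm) cat_scheme \<Rightarrow> 'c \<Rightarrow> 'c \<Rightarrow> 'c set \<Rightarrow> bool" where
  "is_vee C a b F \<longleftrightarrow> finite F \<and> F \<subseteq> mor C \<and>
     right_ideal C a \<inter> right_ideal C b = (\<Union>c \<in> F. right_ideal C c) \<and>
     (\<forall>c \<in> F. \<forall>c' \<in> F. c \<noteq> c' \<longrightarrow> c \<notin> right_ideal C c')"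


section \<open>Representations and the Toeplitz algebra\<close>

definition cat_representation ::
    "('c, 'm) cat_scheme \<Rightarrow> ('b, 'n) cstar_scheme \<Rightarrow> ('c \<Rightarrow> 'b) \<Rightarrow> bool" where
  "cat_representation C B T \<longleftrightarrow>
     (\<forall>a \<in> mor C. T a \<in> carrier B) \<and>
     (\<forall>a \<in> mor C. star B (T a) \<otimes>\<^bsub>B\<^esub> T a = T (src C a)) \<and>
     (\<forall>a \<in> mor C. \<forall>b \<in> mor C. src C a = rng C b \<longrightarrow> T a \<otimes>\<^bsub>B\<^esub> T b = T (a \<cdot>\<^bsub>C\<^esub> b)) \<and>
     (\<forall>a \<in> mor C. \<forall>b \<in> mor C. \<forall>F. is_vee C a b F \<longrightarrow>
        is_join B ((\<lambda>c. T c \<otimes>\<^bsub>B\<^esub> star B (T c)) ` F)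
          ((T a \<otimes>\<^bsub>B\<^esub> star B (T a)) \<otimes>\<^bsub>B\<^esub> (T b \<otimes>\<^bsub>B\<^esub> star B (T b))))"

text \<open>
  The Toeplitz algebra is given by its universal property. The type argument is the universe of
  the test algebras: the property is required of every C*-algebra whose carrier is any set of
  elements of type \<open>'b\<close>. HOL cannot quantify over \<open>'b\<close> inside a formula.
\<close>

definition toeplitz_algebra ::
    "'b itself \<Rightarrow> ('c, 'm) cat_scheme \<Rightarrow> ('a, 'n) cstar_scheme \<Rightarrow> ('c \<Rightarrow> 'a) \<Rightarrow> bool" where
  "toeplitz_algebra (_ :: 'b itself) C A t \<longleftrightarrow>
     cstar_algebra A \<and> cat_representation C A t \<and>
     (\<forall>(B :: 'b cstar) T. cstar_algebra B \<and> cat_representation C B T \<longrightarrow>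
        (\<exists>!\<phi>. \<phi> \<in> cstar_hom A B \<and> (\<forall>a \<in> mor C. \<phi> (t a) = T a)))"


section \<open>Zigzag maps\<close>

text \<open>A partial bijection of \<open>C\<close> is a map \<open>'c \<rightharpoonup> 'c\<close>; \<open>\<circ>\<^sub>m\<close> composes on the largest possible
  domain, \<open>Map.empty\<close> is the identity of the empty set and \<open>Some |` X\<close> that of \<open>X\<close>.\<close>

definition tau :: "('c, 'm) cat_scheme \<Rightarrow> 'c \<Rightarrow> 'c \<rightharpoonup> 'c" where
  "tau C a = (\<lambda>b. if b \<in> right_ideal C (src C a) then Some (a \<cdot>\<^bsub>C\<^esub> b) else None)"

definition pinv :: "('c \<rightharpoonup> 'c) \<Rightarrow> 'c \<rightharpoonup> 'c" where
  "pinv f = (\<lambda>y. if y \<in> ran f then Some (THE x. f x = Some y) else None)"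

definition sigma :: "('c, 'm) cat_scheme \<Rightarrow> 'c \<Rightarrow> 'c \<rightharpoonup> 'c" where
  "sigma C a = pinv (tau C a)"

inductive_set ZM :: "('c, 'm) cat_scheme \<Rightarrow> ('c \<rightharpoonup> 'c) set" for C where
  tau: "a \<in> mor C \<Longrightarrow> tau C a \<in> ZM C"
| empty: "Map.empty \<in> ZM C"
| comp: "f \<in> ZM C \<Longrightarrow> g \<in> ZM C \<Longrightarrow> f \<circ>\<^sub>m g \<in> ZM C"
| inverse: "f \<in> ZM C \<Longrightarrow> pinv f \<in> ZM C"

text \<open>The zigzag \<open>(a\<^sub>1, b\<^sub>1, \<dots>, a\<^sub>n, b\<^sub>n)\<close>, \<open>n \<ge> 1\<close>, is the list of the pairs \<open>(a\<^sub>i, b\<^sub>i)\<close>.\<close>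

definition zigzags :: "('c, 'm) cat_scheme \<Rightarrow> ('c \<times> 'c) list set" where
  "zigzags C = {zs. zs \<noteq> [] \<and>
     (\<forall>(a, b) \<in> set zs. a \<in> mor C \<and> b \<in> mor C \<and> rng C a = rng C b) \<and>
     (\<forall>i. Suc i < length zs \<longrightarrow> src C (snd (zs ! i)) = src C (fst (zs ! Suc i)))}"

definition zigzag_map :: "('c, 'm) cat_scheme \<Rightarrow> ('c \<times> 'c) list \<Rightarrow> 'c \<rightharpoonup> 'c" where
  "zigzag_map C zs = foldr (\<lambda>(a, b) f. (sigma C a \<circ>\<^sub>m tau C b) \<circ>\<^sub>m f) zs Some"

definition zigzag_dom :: "('c, 'm) cat_scheme \<Rightarrow> ('c \<times> 'c) list \<Rightarrow> 'c set" where
  "zigzag_dom C zs = dom (zigzag_map C zs)"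

definition ZM_representation ::
    "('c, 'm) cat_scheme \<Rightarrow> ('b, 'n) cstar_scheme \<Rightarrow> (('c \<rightharpoonup> 'c) \<Rightarrow> 'b) \<Rightarrow> bool" where
  "ZM_representation C B \<pi> \<longleftrightarrow>
     (\<forall>f \<in> ZM C. \<pi> f \<in> carrier B) \<and>
     (\<forall>f \<in> ZM C. \<forall>g \<in> ZM C. \<pi> (f \<circ>\<^sub>m g) = \<pi> f \<otimes>\<^bsub>B\<^esub> \<pi> g) \<and>
     (\<forall>f \<in> ZM C. \<pi> (pinv f) = star B (\<pi> f)) \<and>
     \<pi> Map.empty = \<zero>\<^bsub>B\<^esub>"

definition finitely_join_preserving ::
    "('c, 'm) cat_scheme \<Rightarrow> ('b, 'n) cstar_scheme \<Rightarrow> (('c \<rightharpoonup> 'c) \<Rightarrow> 'b) \<Rightarrow> bool" where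
  "finitely_join_preserving C B \<pi> \<longleftrightarrow>
     (\<forall>z \<in> zigzags C. \<forall>Z. finite Z \<and> Z \<noteq> {} \<and> Z \<subseteq> zigzags C \<and>
        zigzag_dom C z = (\<Union>w \<in> Z. zigzag_dom C w) \<longrightarrow>
        is_join B ((\<lambda>w. \<pi> (Some |` zigzag_dom C w)) ` Z) (\<pi> (Some |` zigzag_dom C z)))"

end

theory Submission
  imports Defs
begin

text \<open>
  The Toeplitz algebra is universal for representations of the category \<open>C\<close>, so it suffices that
  \<open>T a = \<pi> (tau C a)\<close> is such a representation. Multiplicativity and \<open>T\<^sub>a\<^sup>* T\<^sub>a = T\<^bsub>s(a)\<^esub>\<close> are
  identities between partial bijections: \<open>tau\<close> is multiplicative, and \<open>sigma C a\<close> followed or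
  preceded by \<open>tau C a\<close> is the identity of \<open>aC\<close> or of \<open>s(a)C\<close>. In the remaining axiom,
  \<open>T\<^sub>a T\<^sub>a\<^sup>* T\<^sub>b T\<^sub>b\<^sup>*\<close> is the value of \<open>\<pi>\<close> at the identity of \<open>aC \<inter> bC\<close>, which is the union of the ideals
  \<open>cC\<close> with \<open>c \<in> a \<or> b\<close>. All these sets are domains of zigzag maps as soon as \<open>aC \<inter> bC\<close> is nonempty,
  and then the axiom is an instance of finite join preservation
  (\<open>ZM_representation_cat_representation\<close>). Finite join preservation says nothing of an empty union;
  there the axiom holds because \<open>\<pi>\<close> maps the empty map to \<open>0\<close> and the image of \<open>0\<close> is
  the least projection of the bidual (\<open>is_join_empty\<close>).

  The homomorphism \<open>\<phi>\<close> given by the universal property satisfies \<open>\<phi> (\<pi>\<^sub>t f) = \<pi> f\<close> for \<open>f = tau C a\<close>.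
  Both sides respect products and adjoints and vanish at the empty map, and the maps \<open>tau C a\<close>
  generate \<open>ZM C\<close>, so the equation holds on all of \<open>ZM C\<close>. Conversely a homomorphism with
  this property maps each \<open>t a\<close> to \<open>T a\<close>, and the universal property allows only one of these.
\<close>

section \<open>The zero element in the bidual\<close>

lemma dual_carrier_iff:
  "f \<in> carrier (dual V) \<longleftrightarrow> f \<in> extensional (carrier V) \<and>
     (\<forall>x \<in> carrier V. \<forall>y \<in> carrier V. f (x \<oplus>\<^bsub>V\<^esub> y) = f x + f y) \<and>
     (\<forall>c. \<forall>x \<in> carrier V. f (c \<odot>\<^bsub>V\<^esub> x) = c * f x) \<and>
     (\<exists>K. \<forall>x \<in> carrier V. cmod (f x) \<le> K * nrm V x)"
  by (simp add: dual_def)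

lemma dual_select:
  "add (dual V) = (\<lambda>f g. \<lambda>x \<in> carrier V. f x + g x)"
  "scale (dual V) = (\<lambda>c f. \<lambda>x \<in> carrier V. c * f x)"
  "nrm (dual V) = (\<lambda>f. Sup {cmod (f x) | x. x \<in> carrier V \<and> nrm V x \<le> 1})"
  by (simp_all add: dual_def)

lemma bidual_select:
  "carrier (bidual B) = carrier (dual (dual B))"
  "mult (bidual B) = (\<lambda>\<Phi> \<Psi>. \<lambda>f \<in> carrier (dual B).
     \<Phi> (\<lambda>a \<in> carrier B. \<Psi> (\<lambda>b \<in> carrier B. f (a \<otimes>\<^bsub>B\<^esub> b))))"
  "star (bidual B) =
     (\<lambda>\<Phi>. \<lambda>f \<in> carrier (dual B). cnj (\<Phi> (\<lambda>a \<in> carrier B. cnj (f (star B a)))))"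
  by (simp_all add: bidual_def normed_sp.defs cstar.defs)

lemma dual_bounded:
  assumes "f \<in> carrier (dual V)" and "complex_normed_sp V"
  obtains K where "0 \<le> K" and "\<And>x. x \<in> carrier V \<Longrightarrow> cmod (f x) \<le> K * nrm V x"
proof -
  obtain K where K: "\<And>x. x \<in> carrier V \<Longrightarrow> cmod (f x) \<le> K * nrm V x"
    using assms(1) unfolding dual_carrier_iff by blast
  have "cmod (f x) \<le> \<bar>K\<bar> * nrm V x" if x: "x \<in> carrier V" for x
  proof -
    have "K * nrm V x \<le> \<bar>K\<bar> * nrm V x"
      by (intro mult_right_mono) (auto simp: complex_normed_sp.nrm_nonneg[OF assms(2) x])
    then show ?thesis using K[OF x] by linarith
  qed
  then show thesis using that[of "\<bar>K\<bar>"] by simp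
qed

lemma dual_apply_zero:
  assumes "complex_normed_sp V" and "f \<in> carrier (dual V)"
  shows "f \<zero>\<^bsub>V\<^esub> = 0"
proof -
  interpret complex_normed_sp V by fact
  have "f (\<zero>\<^bsub>V\<^esub> \<oplus>\<^bsub>V\<^esub> \<zero>\<^bsub>V\<^esub>) = f \<zero>\<^bsub>V\<^esub> + f \<zero>\<^bsub>V\<^esub>"
    using assms(2) zero_closed unfolding dual_carrier_iff by blast
  then show ?thesis by (simp add: add_zero zero_closed)
qed

lemma dual_nrm_bounds:
  assumes "complex_normed_sp V" and "0 \<le> M"
    and bound: "\<And>x. x \<in> carrier V \<Longrightarrow> cmod (g x) \<le> M * nrm V x"
  shows "0 \<le> nrm (dual V) g" and "nrm (dual V) g \<le> M"
proof -
  interpret complex_normed_sp V by fact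
  let ?S = "{cmod (g x) | x. x \<in> carrier V \<and> nrm V x \<le> 1}"
  have le: "s \<le> M" if s: "s \<in> ?S" for s
  proof -
    obtain x where x: "s = cmod (g x)" "x \<in> carrier V" "nrm V x \<le> 1"
      using s by blast
    have "M * nrm V x \<le> M * 1"
      using x(3) \<open>0 \<le> M\<close> by (rule mult_left_mono)
    then show ?thesis using bound[OF x(2)] x(1) by simp
  qed
  have mem: "cmod (g \<zero>\<^bsub>V\<^esub>) \<in> ?S"
    using zero_closed nrm_eq_0[OF zero_closed] by fastforce
  have "cmod (g \<zero>\<^bsub>V\<^esub>) \<le> Sup ?S"
    using mem le by (intro cSup_upper bdd_aboveI)
  then show "0 \<le> nrm (dual V) g"
    unfolding dual_select using norm_ge_zero[of "g \<zero>\<^bsub>V\<^esub>"] by linarith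
  show "nrm (dual V) g \<le> M"
    unfolding dual_select using mem le by (intro cSup_least) blast+
qed

context cstar_algebra
begin

text \<open>
  The C*-identity at \<open>x\<^sup>*\<close> gives \<open>\<parallel>x\<^sup>*\<parallel>\<^sup>2 = \<parallel>x x\<^sup>*\<parallel> \<le> \<parallel>x\<parallel> \<parallel>x\<^sup>*\<parallel>\<close>, and \<open>\<parallel>x\<^sup>*\<parallel>\<close> cancels unless it is zero.
\<close>

lemma nrm_star_le:
  assumes x: "x \<in> carrier A"
  shows "nrm A (star A x) \<le> nrm A x"
proof (cases "nrm A (star A x) = 0")
  case True
  then show ?thesis using nrm_nonneg[OF x] by simp
next
  case False
  have sx: "star A x \<in> carrier A" using x by (rule star_closed)
  have "nrm A (star A x) * nrm A (star A x) = nrm A (x \<otimes> star A x)"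
    using cstar_identity[OF sx] star_star[OF x] by (simp add: power2_eq_square)
  also have "\<dots> \<le> nrm A x * nrm A (star A x)"
    using nrm_mult[OF x sx] .
  finally show ?thesis
    using False nrm_nonneg[OF sx] by simp
qed

lemma dual_star_closed:
  assumes f: "f \<in> carrier (dual A)"
  shows "(\<lambda>a \<in> carrier A. cnj (f (star A a))) \<in> carrier (dual A)"
proof -
  obtain K where K: "0 \<le> K" "\<And>x. x \<in> carrier A \<Longrightarrow> cmod (f x) \<le> K * nrm A x"
    using dual_bounded[OF f complex_normed_sp_axioms] by blast
  have "cmod (f (star A x)) \<le> K * nrm A x" if x: "x \<in> carrier A" for x
    using K(2)[OF star_closed[OF x]] mult_left_mono[OF nrm_star_le[OF x] K(1)] by linarith
  then show ?thesis
    using f unfolding dual_carrier_iff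
    by (auto simp: add_closed scale_closed star_add star_scale star_closed)
qed

lemma dual_translate_bound:
  assumes f: "f \<in> carrier (dual A)"
  obtains K where "0 \<le> K"
    and "\<And>a b. a \<in> carrier A \<Longrightarrow> b \<in> carrier A \<Longrightarrow> cmod (f (a \<otimes> b)) \<le> K * nrm A a * nrm A b"
proof -
  obtain K where K: "0 \<le> K" "\<And>x. x \<in> carrier A \<Longrightarrow> cmod (f x) \<le> K * nrm A x"
    using dual_bounded[OF f complex_normed_sp_axioms] by blast
  have "cmod (f (a \<otimes> b)) \<le> K * nrm A a * nrm A b" if "a \<in> carrier A" "b \<in> carrier A" for a b
    using K(2)[OF mult_closed[OF that]] mult_left_mono[OF nrm_mult[OF that] K(1)]
    by (simp add: mult.assoc)
  then show thesis using that[OF K(1)] by blast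
qed

lemma dual_translate_closed:
  assumes f: "f \<in> carrier (dual A)" and a: "a \<in> carrier A"
  shows "(\<lambda>b \<in> carrier A. f (a \<otimes> b)) \<in> carrier (dual A)"
proof -
  obtain K where "\<And>b. b \<in> carrier A \<Longrightarrow> cmod (f (a \<otimes> b)) \<le> K * nrm A a * nrm A b"
    using dual_translate_bound[OF f] a by metis
  then show ?thesis
    using f a unfolding dual_carrier_iff
    by (auto simp: add_closed scale_closed mult_closed distrib_left scale_mult_right)
qed

text \<open>
  The inner functional of the Arens product is bounded: \<open>b \<mapsto> f (a b)\<close> has norm at most
  \<open>K \<parallel>a\<parallel>\<close>, where \<open>K\<close> bounds \<open>f\<close>.
\<close>

lemma arens_inner_closed:
  assumes f: "f \<in> carrier (dual A)" and \<Psi>: "\<Psi> \<in> carrier (dual (dual A))"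
  shows "(\<lambda>a \<in> carrier A. \<Psi> (\<lambda>b \<in> carrier A. f (a \<otimes> b))) \<in> carrier (dual A)"
proof -
  let ?g = "\<lambda>a. \<lambda>b \<in> carrier A. f (a \<otimes> b)"
  have g: "?g a \<in> carrier (dual A)" if "a \<in> carrier A" for a
    using dual_translate_closed[OF f that] .
  have f_lin: "f (x \<oplus> y) = f x + f y" "f (c \<odot> x) = c * f x"
    if "x \<in> carrier A" "y \<in> carrier A" for x y c
    using f that unfolding dual_carrier_iff by blast+
  have \<Psi>_add: "\<Psi> (add (dual A) u v) = \<Psi> u + \<Psi> v"
    if "u \<in> carrier (dual A)" "v \<in> carrier (dual A)" for u v
    using \<Psi> that unfolding dual_carrier_iff[of \<Psi>] by blast
  have \<Psi>_scale: "\<Psi> (scale (dual A) c u) = c * \<Psi> u" if "u \<in> carrier (dual A)" for c u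
    using \<Psi> that unfolding dual_carrier_iff[of \<Psi>] by blast
  have add: "\<Psi> (?g (x \<oplus> y)) = \<Psi> (?g x) + \<Psi> (?g y)"
    if "x \<in> carrier A" "y \<in> carrier A" for x y
  proof -
    have "?g (x \<oplus> y) = add (dual A) (?g x) (?g y)"
      unfolding dual_select using that
      by (auto simp: fun_eq_iff restrict_def distrib_right f_lin mult_closed)
    then show ?thesis using \<Psi>_add g that by simp
  qed
  have scale: "\<Psi> (?g (c \<odot> x)) = c * \<Psi> (?g x)" if "x \<in> carrier A" for c x
  proof -
    have "?g (c \<odot> x) = scale (dual A) c (?g x)"
      unfolding dual_select using that
      by (auto simp: fun_eq_iff restrict_def scale_mult_left f_lin mult_closed)
    then show ?thesis using \<Psi>_scale g that by simp
  qed
  obtain L where L: "\<And>u. u \<in> carrier (dual A) \<Longrightarrow> cmod (\<Psi> u) \<le> L * nrm (dual A) u"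
    using \<Psi> unfolding dual_carrier_iff[of \<Psi>] by blast
  obtain K where K: "0 \<le> K"
    "\<And>a b. a \<in> carrier A \<Longrightarrow> b \<in> carrier A \<Longrightarrow> cmod (f (a \<otimes> b)) \<le> K * nrm A a * nrm A b"
    using dual_translate_bound[OF f] by blast
  have bound: "cmod (\<Psi> (?g a)) \<le> (\<bar>L\<bar> * K) * nrm A a" if a: "a \<in> carrier A" for a
  proof -
    have M: "0 \<le> K * nrm A a" using K(1) nrm_nonneg[OF a] by simp
    have nrm_g: "0 \<le> nrm (dual A) (?g a)" "nrm (dual A) (?g a) \<le> K * nrm A a"
      using dual_nrm_bounds[OF complex_normed_sp_axioms M, of "?g a"] K(2)[OF a] by simp_all
    have "cmod (\<Psi> (?g a)) \<le> L * nrm (dual A) (?g a)" using L[OF g[OF a]] .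
    also have "\<dots> \<le> \<bar>L\<bar> * nrm (dual A) (?g a)" using nrm_g(1) by (intro mult_right_mono) auto
    also have "\<dots> \<le> \<bar>L\<bar> * (K * nrm A a)" using nrm_g(2) by (intro mult_left_mono) auto
    finally show ?thesis by (simp add: mult.assoc)
  qed
  show ?thesis
    unfolding dual_carrier_iff using add scale bound
    by (auto simp: add_closed scale_closed intro: exI[of _ "\<bar>L\<bar> * K"])
qed

lemma bidual_emb_zero: "bidual_emb A \<zero> = (\<lambda>f \<in> carrier (dual A). 0)"
  unfolding bidual_emb_def
  using dual_apply_zero[OF complex_normed_sp_axioms] by (auto simp: fun_eq_iff restrict_def)

text \<open>
  Elements of the bidual are extensional, so the zero functional takes the value \<open>0\<close> only at
  elements of the dual. The Arens product evaluates it at the inner functional, which must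
  therefore be known to be bounded and linear; the involution needs \<open>dual_star_closed\<close> for the
  same reason.
\<close>

lemma bidual_zero_mult:
  assumes "\<Psi> \<in> carrier (bidual A)"
  shows "bidual_emb A \<zero> \<otimes>\<^bsub>bidual A\<^esub> \<Psi> = bidual_emb A \<zero>"
  using arens_inner_closed assms unfolding bidual_select bidual_emb_zero
  by (auto simp: fun_eq_iff restrict_def)

lemma projection_bidual_zero: "projection (bidual A) (bidual_emb A \<zero>)"
proof -
  have add_dual: "add (dual A) u v \<in> carrier (dual A)"
    if u: "u \<in> carrier (dual A)" and v: "v \<in> carrier (dual A)" for u v
  proof -
    obtain K where K: "\<And>x. x \<in> carrier A \<Longrightarrow> cmod (u x) \<le> K * nrm A x"
      using dual_bounded[OF u complex_normed_sp_axioms] by blast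
    obtain L where L: "\<And>x. x \<in> carrier A \<Longrightarrow> cmod (v x) \<le> L * nrm A x"
      using dual_bounded[OF v complex_normed_sp_axioms] by blast
    have "cmod (u x + v x) \<le> (K + L) * nrm A x" if "x \<in> carrier A" for x
      using norm_triangle_ineq[of "u x" "v x"] K[OF that] L[OF that]
      by (simp add: ring_distribs)
    then have "\<exists>M. \<forall>x \<in> carrier A. cmod (u x + v x) \<le> M * nrm A x" by blast
    then show ?thesis
      using u v unfolding dual_carrier_iff dual_select
      by (auto simp: add_closed scale_closed algebra_simps)
  qed
  have scale_dual: "scale (dual A) c u \<in> carrier (dual A)" if u: "u \<in> carrier (dual A)" for c u
  proof -
    obtain K where K: "\<And>x. x \<in> carrier A \<Longrightarrow> cmod (u x) \<le> K * nrm A x"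
      using dual_bounded[OF u complex_normed_sp_axioms] by blast
    have "cmod (c * u x) \<le> (cmod c * K) * nrm A x" if "x \<in> carrier A" for x
      using mult_left_mono[OF K[OF that], of "cmod c"] by (simp add: norm_mult mult.assoc)
    then have "\<exists>M. \<forall>x \<in> carrier A. cmod (c * u x) \<le> M * nrm A x" by blast
    then show ?thesis
      using u unfolding dual_carrier_iff dual_select
      by (auto simp: add_closed scale_closed algebra_simps)
  qed
  have "bidual_emb A \<zero> \<in> carrier (bidual A)"
    unfolding bidual_select bidual_emb_zero dual_carrier_iff[of _ "dual A"]
    using add_dual scale_dual by (auto intro: exI[of _ 0])
  moreover have "star (bidual A) (bidual_emb A \<zero>) = bidual_emb A \<zero>"
    using dual_star_closed unfolding bidual_select bidual_emb_zero
    by (auto simp: fun_eq_iff restrict_def)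
  ultimately show ?thesis
    unfolding projection_def using bidual_zero_mult by blast
qed

text \<open>
  The least upper bound of no projections is the least projection, and \<open>0\<close> lies below every
  element of the bidual because it absorbs products.
\<close>

lemma is_join_empty: "is_join A {} \<zero>"
  unfolding is_join_def is_proj_lub_def proj_le_def
  using projection_bidual_zero bidual_zero_mult zero_closed by (auto simp: projection_def)

end

lemma cstar_hom_zero:
  assumes \<phi>: "\<phi> \<in> cstar_hom A B" and "cstar_algebra A" and "cstar_algebra B"
  shows "\<phi> \<zero>\<^bsub>A\<^esub> = \<zero>\<^bsub>B\<^esub>"
proof -
  interpret A: cstar_algebra A by fact
  interpret B: cstar_algebra B by fact
  have "\<phi> \<zero>\<^bsub>A\<^esub> = \<phi> (\<zero>\<^bsub>A\<^esub> \<oplus>\<^bsub>A\<^esub> ((-1) \<odot>\<^bsub>A\<^esub> \<zero>\<^bsub>A\<^esub>))"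
    using A.add_neg[OF A.zero_closed] by simp
  also have "\<dots> = \<phi> \<zero>\<^bsub>A\<^esub> \<oplus>\<^bsub>B\<^esub> ((-1) \<odot>\<^bsub>B\<^esub> \<phi> \<zero>\<^bsub>A\<^esub>)"
    using \<phi> A.zero_closed A.scale_closed unfolding cstar_hom_def by simp
  also have "\<dots> = \<zero>\<^bsub>B\<^esub>"
    using \<phi> A.zero_closed by (intro B.add_neg) (auto simp: cstar_hom_def)
  finally show ?thesis .
qed


section \<open>The calculus of the maps \<open>tau\<close> and \<open>sigma\<close>\<close>

lemma map_eqI:
  assumes "\<And>x y. f x = Some y \<longleftrightarrow> g x = Some y"
  shows "f = g"
  using assms by (metis not_Some_eq ext)

lemma pinv_eq_Some_iff:
  assumes inj: "\<And>x x' y. f x = Some y \<Longrightarrow> f x' = Some y \<Longrightarrow> x = x'"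
  shows "pinv f y = Some x \<longleftrightarrow> f x = Some y"
proof -
  have "(THE x. f x = Some y) = x" if "f x = Some y" for x
    using that inj by (intro the_equality) auto
  then show ?thesis
    unfolding pinv_def ran_def by auto
qed

lemma restrict_Some_eq_Some_iff: "(Some |` X) x = Some y \<longleftrightarrow> x \<in> X \<and> y = x"
  by (auto simp: restrict_map_def)

context left_cancellative_category
begin

lemma src_src: "a \<in> mor C \<Longrightarrow> src C (src C a) = src C a"
  by (simp add: src_obj src_id)

lemma rng_rng: "a \<in> mor C \<Longrightarrow> rng C (rng C a) = rng C a"
  by (simp add: rng_obj rng_id)

lemma src_rng: "a \<in> mor C \<Longrightarrow> src C (rng C a) = rng C a"
  by (simp add: rng_obj src_id)

lemma rng_src: "a \<in> mor C \<Longrightarrow> rng C (src C a) = src C a"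
  by (simp add: src_obj rng_id)

lemma rng_mor: "a \<in> mor C \<Longrightarrow> rng C a \<in> mor C"
  using rng_obj obj_mor by blast

lemma src_mor: "a \<in> mor C \<Longrightarrow> src C a \<in> mor C"
  using src_obj obj_mor by blast

lemma right_ideal_iff:
  "x \<in> right_ideal C a \<longleftrightarrow> (\<exists>b. b \<in> mor C \<and> rng C b = src C a \<and> x = a \<cdot> b)"
  by (auto simp: right_ideal_def)

lemma right_ideal_obj:
  assumes "v \<in> obj C"
  shows "right_ideal C v = {b \<in> mor C. rng C b = v}"
  using assms cmp_rng src_id unfolding right_ideal_def by (auto, metis+)

lemma right_ideal_rng:
  assumes "a \<in> mor C" and "x \<in> right_ideal C a"
  shows "x \<in> mor C" and "rng C x = rng C a"
  using assms cmp_closed rng_cmp unfolding right_ideal_iff by auto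

lemma right_ideal_self: "a \<in> mor C \<Longrightarrow> a \<in> right_ideal C a"
  unfolding right_ideal_iff using src_mor rng_src cmp_src by metis

lemma tau_eq_Some_iff:
  assumes "a \<in> mor C"
  shows "tau C a x = Some y \<longleftrightarrow> x \<in> mor C \<and> rng C x = src C a \<and> y = a \<cdot> x"
  using right_ideal_obj[OF src_obj[OF assms]] by (auto simp: tau_def)

lemma sigma_eq_Some_iff:
  assumes "a \<in> mor C"
  shows "sigma C a y = Some x \<longleftrightarrow> x \<in> mor C \<and> rng C x = src C a \<and> y = a \<cdot> x"
  unfolding sigma_def tau_eq_Some_iff[OF assms, symmetric]
  by (rule pinv_eq_Some_iff) (auto simp: tau_eq_Some_iff[OF assms] intro: left_cancel[OF assms])

lemma sigma_comp_tau:
  assumes "a \<in> mor C"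
  shows "sigma C a \<circ>\<^sub>m tau C a = tau C (src C a)"
  using assms left_cancel[OF assms] cmp_rng
  by (intro map_eqI)
     (auto simp: map_comp_Some_iff tau_eq_Some_iff sigma_eq_Some_iff src_mor src_src, metis+)

lemma tau_comp_tau:
  assumes "a \<in> mor C" "b \<in> mor C" "src C a = rng C b"
  shows "tau C a \<circ>\<^sub>m tau C b = tau C (a \<cdot> b)"
  using assms
  by (intro map_eqI)
     (auto simp: map_comp_Some_iff tau_eq_Some_iff cmp_closed src_cmp rng_cmp cmp_assoc)

lemma tau_comp_sigma:
  assumes "a \<in> mor C"
  shows "tau C a \<circ>\<^sub>m sigma C a = Some |` right_ideal C a"
  using assms
  by (intro map_eqI)
     (auto simp: map_comp_Some_iff tau_eq_Some_iff sigma_eq_Some_iff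
       restrict_Some_eq_Some_iff right_ideal_iff)

text \<open>
  A zigzag map ends in some \<open>\<tau>\<close>, so a trailing \<open>\<sigma>\<^sub>a\<close> has to be written as \<open>\<sigma>\<^sub>a \<tau>\<^bsub>r(a)\<^esub>\<close>. The
  factor \<open>\<tau>\<^bsub>r(a)\<^esub>\<close> is the identity of \<open>r(a)C\<close>, which contains the domain \<open>aC\<close> of \<open>\<sigma>\<^sub>a\<close>.
\<close>

lemma sigma_comp_tau_rng:
  assumes a: "a \<in> mor C"
  shows "sigma C a \<circ>\<^sub>m tau C (rng C a) = sigma C a"
proof (rule map_eqI)
  fix y x
  show "(sigma C a \<circ>\<^sub>m tau C (rng C a)) y = Some x \<longleftrightarrow> sigma C a y = Some x"
  proof
    assume "(sigma C a \<circ>\<^sub>m tau C (rng C a)) y = Some x"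
    then obtain z where z: "tau C (rng C a) y = Some z" "sigma C a z = Some x"
      by (auto simp: map_comp_Some_iff)
    have "y \<in> mor C" "rng C y = rng C a" "z = rng C a \<cdot> y"
      using z(1) a by (auto simp: tau_eq_Some_iff rng_mor src_rng)
    then have "z = y" using cmp_rng by metis
    then show "sigma C a y = Some x" using z(2) by simp
  next
    assume y: "sigma C a y = Some x"
    then have "y \<in> right_ideal C a"
      using a by (auto simp: sigma_eq_Some_iff right_ideal_iff)
    then have "tau C (rng C a) y = Some y"
      using a right_ideal_rng[OF a] cmp_rng[of y] by (simp add: tau_eq_Some_iff rng_mor src_rng)
    then show "(sigma C a \<circ>\<^sub>m tau C (rng C a)) y = Some x"
      using y by (simp add: map_comp_Some_iff)
  qed
qed

lemma zigzag_right_ideal: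
  assumes "c \<in> mor C"
  shows "[(c, rng C c)] \<in> zigzags C" and "zigzag_dom C [(c, rng C c)] = right_ideal C c"
proof -
  show "[(c, rng C c)] \<in> zigzags C"
    using assms by (simp add: zigzags_def rng_mor rng_rng)
  show "zigzag_dom C [(c, rng C c)] = right_ideal C c"
    using assms by (auto simp: zigzag_dom_def zigzag_map_def sigma_comp_tau_rng dom_def
        map_comp_Some_iff sigma_eq_Some_iff right_ideal_iff)
qed

text \<open>
  The map \<open>\<sigma>\<^sub>a \<tau>\<^sub>b\<close> alone has as its domain the \<open>y\<close> with \<open>b y\<close> in \<open>aC\<close>; applying \<open>\<sigma>\<^sub>b\<close> first moves this
  set into \<open>bC\<close>. The zigzag condition is what forces \<open>r(a) = r(b)\<close>.
\<close>

lemma zigzag_right_ideal_Int: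
  assumes a: "a \<in> mor C" and b: "b \<in> mor C" and rng: "rng C a = rng C b"
  shows "[(a, b), (b, rng C b)] \<in> zigzags C"
    and "zigzag_dom C [(a, b), (b, rng C b)] = right_ideal C a \<inter> right_ideal C b"
proof -
  show "[(a, b), (b, rng C b)] \<in> zigzags C"
    using assms by (simp add: zigzags_def rng_mor rng_rng)
  show "zigzag_dom C [(a, b), (b, rng C b)] = right_ideal C a \<inter> right_ideal C b"
    using assms by (auto simp: zigzag_dom_def zigzag_map_def sigma_comp_tau_rng dom_def
        map_comp_Some_iff tau_eq_Some_iff sigma_eq_Some_iff right_ideal_iff, metis+)
qed


section \<open>From representations of \<open>ZM C\<close> to representations of \<open>C\<close>\<close>

text \<open>
  If some \<open>c\<close> lies in \<open>a \<or> b\<close>, then \<open>c\<close> belongs to both \<open>aC\<close> and \<open>bC\<close>, so \<open>a\<close> and \<open>b\<close> have a common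
  range and \<open>aC \<inter> bC\<close> is the domain of a zigzag map. The case of an empty \<open>a \<or> b\<close> is
  covered by \<open>\<pi>\<close> sending the empty map to \<open>0\<close>.
\<close>

lemma ZM_representation_vee_join:
  assumes B: "cstar_algebra B" and rep: "ZM_representation C B \<pi>"
    and jp: "finitely_join_preserving C B \<pi>"
    and a: "a \<in> mor C" and b: "b \<in> mor C" and vee: "is_vee C a b F"
  shows "is_join B ((\<lambda>c. \<pi> (Some |` right_ideal C c)) ` F)
    (\<pi> (Some |` (right_ideal C a \<inter> right_ideal C b)))"
proof (cases "F = {}")
  case True
  then have "right_ideal C a \<inter> right_ideal C b = {}"
    using vee by (simp add: is_vee_def)
  then have "\<pi> (Some |` (right_ideal C a \<inter> right_ideal C b)) = \<zero>\<^bsub>B\<^esub>"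
    using rep by (simp add: ZM_representation_def)
  then show ?thesis
    using True cstar_algebra.is_join_empty[OF B] by simp
next
  case False
  have F: "finite F" "F \<subseteq> mor C"
    "right_ideal C a \<inter> right_ideal C b = (\<Union>c \<in> F. right_ideal C c)"
    using vee by (auto simp: is_vee_def)
  obtain c where "c \<in> F" using False by blast
  then have "c \<in> right_ideal C a" "c \<in> right_ideal C b"
    using F(2,3) right_ideal_self by blast+
  then have rng: "rng C a = rng C b"
    using right_ideal_rng(2) a b by metis
  let ?Z = "(\<lambda>c. [(c, rng C c)]) ` F"
  have "zigzag_dom C [(a, b), (b, rng C b)] = (\<Union>w \<in> ?Z. zigzag_dom C w)"
    using F(2,3) zigzag_right_ideal(2) zigzag_right_ideal_Int(2)[OF a b rng]
    by (simp add: subset_iff)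
  moreover have "finite ?Z" "?Z \<noteq> {}" "?Z \<subseteq> zigzags C"
    using F False zigzag_right_ideal(1) by auto
  ultimately have "is_join B ((\<lambda>w. \<pi> (Some |` zigzag_dom C w)) ` ?Z)
      (\<pi> (Some |` zigzag_dom C [(a, b), (b, rng C b)]))"
    using jp zigzag_right_ideal_Int(1)[OF a b rng] unfolding finitely_join_preserving_def by blast
  moreover have "(\<lambda>w. \<pi> (Some |` zigzag_dom C w)) ` ?Z = (\<lambda>c. \<pi> (Some |` right_ideal C c)) ` F"
    unfolding image_image using F(2) zigzag_right_ideal(2) by (intro image_cong) auto
  ultimately show ?thesis
    using zigzag_right_ideal_Int(2)[OF a b rng] by simp
qed

lemma ZM_representation_cat_representation:
  assumes B: "cstar_algebra B" and rep: "ZM_representation C B \<pi>"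
    and jp: "finitely_join_preserving C B \<pi>"
  shows "cat_representation C B (\<lambda>a. \<pi> (tau C a))"
proof -
  have comp: "\<pi> (f \<circ>\<^sub>m g) = \<pi> f \<otimes>\<^bsub>B\<^esub> \<pi> g" if "f \<in> ZM C" "g \<in> ZM C" for f g
    using rep that by (simp add: ZM_representation_def)
  have sigma: "sigma C a \<in> ZM C" "\<pi> (sigma C a) = star B (\<pi> (tau C a))" if "a \<in> mor C" for a
    using rep ZM.tau[OF that] unfolding ZM_representation_def sigma_def
    by (auto intro: ZM.inverse)
  have ideal: "Some |` right_ideal C a \<in> ZM C" if "a \<in> mor C" for a
    using ZM.comp[OF ZM.tau[OF that] sigma(1)[OF that]] tau_comp_sigma[OF that] by simp
  have range: "\<pi> (tau C a) \<otimes>\<^bsub>B\<^esub> star B (\<pi> (tau C a)) = \<pi> (Some |` right_ideal C a)"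
    if "a \<in> mor C" for a
    using comp[OF ZM.tau[OF that] sigma(1)[OF that]] sigma(2)[OF that] tau_comp_sigma[OF that]
    by simp
  have "is_join B ((\<lambda>c. \<pi> (tau C c) \<otimes>\<^bsub>B\<^esub> star B (\<pi> (tau C c))) ` F)
      ((\<pi> (tau C a) \<otimes>\<^bsub>B\<^esub> star B (\<pi> (tau C a))) \<otimes>\<^bsub>B\<^esub> (\<pi> (tau C b) \<otimes>\<^bsub>B\<^esub> star B (\<pi> (tau C b))))"
    if ab: "a \<in> mor C" "b \<in> mor C" and vee: "is_vee C a b F" for a b F
  proof -
    have "(\<lambda>c. \<pi> (tau C c) \<otimes>\<^bsub>B\<^esub> star B (\<pi> (tau C c))) ` F = (\<lambda>c. \<pi> (Some |` right_ideal C c)) ` F"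
      using vee range by (intro image_cong) (auto simp: is_vee_def)
    moreover have "(Some |` right_ideal C a) \<circ>\<^sub>m (Some |` right_ideal C b)
        = Some |` (right_ideal C a \<inter> right_ideal C b)"
      by (intro map_eqI) (auto simp: map_comp_Some_iff restrict_Some_eq_Some_iff)
    then have "\<pi> (Some |` right_ideal C a) \<otimes>\<^bsub>B\<^esub> \<pi> (Some |` right_ideal C b)
        = \<pi> (Some |` (right_ideal C a \<inter> right_ideal C b))"
      using comp[OF ideal ideal] ab by metis
    ultimately show ?thesis
      using ZM_representation_vee_join[OF B rep jp ab vee] range ab by simp
  qed
  moreover have "star B (\<pi> (tau C a)) \<otimes>\<^bsub>B\<^esub> \<pi> (tau C a) = \<pi> (tau C (src C a))"
    if "a \<in> mor C" for a
    using comp[OF sigma(1)[OF that] ZM.tau[OF that]] sigma(2)[OF that] sigma_comp_tau[OF that]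
    by simp
  moreover have "\<pi> (tau C a) \<otimes>\<^bsub>B\<^esub> \<pi> (tau C b) = \<pi> (tau C (a \<cdot> b))"
    if "a \<in> mor C" "b \<in> mor C" "src C a = rng C b" for a b
    using comp[OF ZM.tau[OF that(1)] ZM.tau[OF that(2)]] tau_comp_tau[OF that] by simp
  moreover have "\<pi> (tau C a) \<in> carrier B" if "a \<in> mor C" for a
    using rep ZM.tau[OF that] by (simp add: ZM_representation_def)
  ultimately show ?thesis
    unfolding cat_representation_def by blast
qed

end

text \<open>
  Every property of representations and homomorphisms used here matches one rule of the
  inductive definition of \<open>ZM\<close>, so agreement on the generators propagates.
\<close>

lemma ZM_representation_hom_eqI:
  assumes A: "cstar_algebra A" and B: "cstar_algebra B"
    and \<rho>: "ZM_representation C A \<rho>" and \<pi>: "ZM_representation C B \<pi>"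
    and \<phi>: "\<phi> \<in> cstar_hom A B"
    and tau: "\<And>a. a \<in> mor C \<Longrightarrow> \<phi> (\<rho> (tau C a)) = \<pi> (tau C a)"
    and f: "f \<in> ZM C"
  shows "\<phi> (\<rho> f) = \<pi> f"
  using f
proof induction
  case (tau a)
  then show ?case by (rule assms(6))
next
  case empty
  show ?case
    using \<rho> \<pi> cstar_hom_zero[OF \<phi> A B] by (simp add: ZM_representation_def)
next
  case (comp f g)
  then show ?case
    using \<rho> \<pi> \<phi> by (simp add: ZM_representation_def cstar_hom_def)
next
  case (inverse f)
  then show ?case
    using \<rho> \<pi> \<phi> by (simp add: ZM_representation_def cstar_hom_def)
qed

theorem corollary7p7:
  fixes C :: "'c cat"
    and A :: "'a cstar" and t :: "'c \<Rightarrow> 'a"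
    and B :: "'b cstar" and \<pi> :: "('c \<rightharpoonup> 'c) \<Rightarrow> 'b"
    and \<pi>\<^sub>t :: "('c \<rightharpoonup> 'c) \<Rightarrow> 'a"
  assumes "left_cancellative_category C"
    and "finitely_aligned C"
    and "toeplitz_algebra TYPE('b) C A t"
    and "cstar_algebra B"
    and "ZM_representation C B \<pi>"
    and "finitely_join_preserving C B \<pi>"
    and "ZM_representation C A \<pi>\<^sub>t"
    and "finitely_join_preserving C A \<pi>\<^sub>t"
    and "\<forall>a \<in> mor C. \<pi>\<^sub>t (tau C a) = t a"
  shows "\<exists>!\<phi>. \<phi> \<in> cstar_hom A B \<and> (\<forall>f \<in> ZM C. \<phi> (\<pi>\<^sub>t f) = \<pi> f)"
proof -
  have A: "cstar_algebra A"
    using assms(3) by (simp add: toeplitz_algebra_def)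
  have "cat_representation C B (\<lambda>a. \<pi> (tau C a))"
    using left_cancellative_category.ZM_representation_cat_representation assms(1,4-6) by blast
  then have universal: "\<exists>!\<phi>. \<phi> \<in> cstar_hom A B \<and> (\<forall>a \<in> mor C. \<phi> (t a) = \<pi> (tau C a))"
    using assms(3,4) by (simp add: toeplitz_algebra_def)
  have "(\<forall>f \<in> ZM C. \<phi> (\<pi>\<^sub>t f) = \<pi> f) \<longleftrightarrow> (\<forall>a \<in> mor C. \<phi> (t a) = \<pi> (tau C a))"
    if "\<phi> \<in> cstar_hom A B" for \<phi>
  proof
    assume "\<forall>f \<in> ZM C. \<phi> (\<pi>\<^sub>t f) = \<pi> f"
    then show "\<forall>a \<in> mor C. \<phi> (t a) = \<pi> (tau C a)"
      using assms(9) ZM.tau by metis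
  next
    assume "\<forall>a \<in> mor C. \<phi> (t a) = \<pi> (tau C a)"
    then show "\<forall>f \<in> ZM C. \<phi> (\<pi>\<^sub>t f) = \<pi> f"
      using ZM_representation_hom_eqI[OF A assms(4,7,5) that] assms(9) by simp
  qed
  then show ?thesis
    using universal by (simp cong: conj_cong)
qed

end
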